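(* Consider the capital-dependent Parrondo games $A$ and $B$ with parameter $\rho$ and bias parameter $\varepsilon>0$. For every $\rho\in(0,1)$, and for every pair of positive integers $r$ and $s$ except $r=s=1$, there exists $\varepsilon_0>0$, depending on $\rho$, $r$, and $s$, such that Parrondo's paradox holds for games $A$ and $B$ and pattern $[r,s]$, that is, $\mu_A(\varepsilon)<0$, $\mu_B(\varepsilon)<0$, and $\mu_{[r,s]}(\varepsilon)>0$, whenever $0<\varepsilon<\varepsilon_0$.
   Context: For $p_0,p_1,p_2\in(0,1)$ let, on state space $\Sigma=\{0,1,2\}$ (current capital modulo 3), $$\boldsymbol{P}(p_0,p_1,p_2):=\begin{pmatrix} 0 & p_0 & 1-p_0 \\ 1-p_1 & 0 & p_1 \\ p_2 & 1-p_2 & 0 \end{pmatrix},\qquad (w(i,j))_{i,j\in\Sigma}:=\begin{pmatrix} 0 & 1 & -1 \\ -1 & 0 & 1 \\ 1 & -1 & 0 \end{pmatrix},$$ where $w(i,j)$ is the payoff (profit) of a transition from $i$ to $j$. Let $\varepsilon>0$ be a small bias parameter (small enough that all probabilities below lie in $(0,1)$). Game $A$ has transition matrix $\boldsymbol{P}_A:=\boldsymbol{P}(\tfrac12-\varepsilon,\tfrac12-\varepsilon,\tfrac12-\varepsilon)$ and game $B$ has transition matrix $\boldsymbol{P}_B:=\boldsymbol{P}(p_0,p_1,p_2)$ with $p_0:=\frac{\rho^2}{1+\rho^2}-\varepsilon$ and $p_1=p_2:=\frac1{1+\rho}-\varepsilon$. $\mu_A(\varepsilon)$ and $\mu_B(\varepsilon)$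 are the asymptotic mean profits per game of games $A$ and $B$: for $G\in\{A,B\}$, $\mu_G(\varepsilon):=\sum_{i,j}\pi_i(\boldsymbol{P}_G)_{ij}w(i,j)$ with $(\pi_i)$ the unique stationary distribution of $\boldsymbol{P}_G$. The pattern $[r,s]$ denotes $r$ plays of game $A$ followed by $s$ plays of game $B$, repeated ad infinitum. With $\boldsymbol{\pi}$ the unique stationary distribution of $\boldsymbol{P}_A^r\boldsymbol{P}_B^s$, the asymptotic mean profit per game played is $$\mu_{[r,s]}(\varepsilon):=\frac1{r+s}\Big(\sum_{u=0}^{r-1}\sum_{i,j}(\boldsymbol{\pi}\boldsymbol{P}_A^u)_i(\boldsymbol{P}_A)_{ij}w(i,j)+\sum_{v=0}^{s-1}\sum_{i,j}(\boldsymbol{\pi}\boldsymbol{P}_A^r\boldsymbol{P}_B^v)_i(\boldsymbol{P}_B)_{ij}w(i,j)\Big).$$ *)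

theory Defs
  imports "HOL-Analysis.Analysis"
begin

text \<open>
  The state space is the library type \<^typ>\<open>3\<close> of integers modulo 3, so the states are
  \<open>0, 1, 2\<close> (and the numeral \<open>3\<close> denotes the state \<open>0\<close>; in particular
  \<^const>\<open>vector\<close>, which lists the entries at \<open>1, 2, 3\<close>, is not used below).
  The term \<open>by_state a b c\<close> lists values in the order of the states \<open>0, 1, 2\<close>.
\<close>

definition by_state :: "'a \<Rightarrow> 'a \<Rightarrow> 'a \<Rightarrow> 3 \<Rightarrow> 'a" where
  "by_state a b c i = (if i = 0 then a else if i = 1 then b else c)"

lemma by_state_simps [simp]:
  "by_state a b c 0 = a"
  "by_state a b c 1 = b"
  "by_state a b c 2 = c"
  by (simp_all add: by_state_def)

lemma UNIV_states: "(UNIV :: 3 set) = {0, 1, 2}"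
proof -
  have "(3::3) = 0"
    by simp
  then show ?thesis
    unfolding UNIV_3 by (simp only: insert_commute)
qed

lemma sum_states: "(\<Sum>i\<in>UNIV. f i) = f (0::3) + f 1 + f 2"
proof -
  have "(3::3) = 0"
    by simp
  then show ?thesis
    unfolding sum_3 by (simp only: add_ac)
qed

definition trans_mat :: "real \<Rightarrow> real \<Rightarrow> real \<Rightarrow> real^3^3" where
  "trans_mat p0 p1 p2 = (\<chi> i j.
     by_state
       (by_state 0        p0       (1 - p0))
       (by_state (1 - p1) 0        p1)
       (by_state p2       (1 - p2) 0) i j)"

definition payoff :: "real^3^3" where
  "payoff = (\<chi> i j.
     by_state
       (by_state 0    1    (-1))
       (by_state (-1) 0    1)
       (by_state 1    (-1) 0) i j)"

text \<open>The operation \<open>^\<close> on \<^typ>\<open>real^3^3\<close> is entrywise, hence the explicit iteration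
  of the matrix product.\<close>

definition mat_power :: "real^3^3 \<Rightarrow> nat \<Rightarrow> real^3^3" where
  "mat_power A n = (((**) A) ^^ n) (mat 1)"

definition stationary_distribution :: "real^3^3 \<Rightarrow> real^3 \<Rightarrow> bool" where
  "stationary_distribution P \<pi> \<longleftrightarrow>
     (\<forall>i. 0 \<le> \<pi> $ i) \<and> (\<Sum>i\<in>UNIV. \<pi> $ i) = 1 \<and> \<pi> v* P = \<pi>"

definition the_stationary :: "real^3^3 \<Rightarrow> real^3" where
  "the_stationary P = (THE \<pi>. stationary_distribution P \<pi>)"

text \<open>Expected profit of one play with transition matrix \<open>P\<close> from a state with distribution \<open>v\<close>.\<close>

definition expected_profit :: "real^3 \<Rightarrow> real^3^3 \<Rightarrow> real" where
  "expected_profit v P = (\<Sum>i\<in>UNIV. \<Sum>j\<in>UNIV. v $ i * P $ i $ j * payoff $ i $ j)"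

definition game_A :: "real \<Rightarrow> real^3^3" where
  "game_A \<epsilon> = trans_mat (1/2 - \<epsilon>) (1/2 - \<epsilon>) (1/2 - \<epsilon>)"

definition game_B :: "real \<Rightarrow> real \<Rightarrow> real^3^3" where
  "game_B \<rho> \<epsilon> =
     trans_mat (\<rho>\<^sup>2 / (1 + \<rho>\<^sup>2) - \<epsilon>) (1 / (1 + \<rho>) - \<epsilon>) (1 / (1 + \<rho>) - \<epsilon>)"

definition mean_profit :: "real^3^3 \<Rightarrow> real" where
  "mean_profit P = expected_profit (the_stationary P) P"

definition pattern_mean_profit :: "real^3^3 \<Rightarrow> real^3^3 \<Rightarrow> nat \<Rightarrow> nat \<Rightarrow> real" where
  "pattern_mean_profit A B r s =
     (let \<pi> = the_stationary (mat_power A r ** mat_power B s) in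
       1 / real (r + s) *
         ((\<Sum>u<r. expected_profit (\<pi> v* mat_power A u) A) +
          (\<Sum>v<s. expected_profit (\<pi> v* (mat_power A r ** mat_power B v)) B)))"

end

theory Submission
  imports Defs
begin

text \<open>
  At \<open>\<epsilon> = 0\<close> game \<open>A\<close> earns nothing and contracts every distribution to the uniform one by the
  factor \<open>-1/2\<close> per play. The profit vector \<open>f\<close> of game \<open>B\<close> satisfies \<open>B\<^sup>2 f + B f + d f = 0\<close> with
  \<open>0 < d < 1/4\<close>, so it splits into eigenvectors for \<open>-x\<^sub>1, -x\<^sub>2\<close>, where \<open>x\<^sub>1 + x\<^sub>2 = 1\<close> and
  \<open>0 < x\<^sub>1 < x\<^sub>2\<close>. With \<open>c = (-1/2)\<^sup>r\<close> and \<open>t\<^sub>i = (-x\<^sub>i)\<^sup>s\<close> the profit per period of the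
  pattern becomes a positive multiple of
  \<open>(1 - t\<^sub>1)(1 - c t\<^sub>2)(1 + x\<^sub>2)\<^sup>2 - (1 - t\<^sub>2)(1 - c t\<^sub>1)(1 + x\<^sub>1)\<^sup>2\<close>,
  which vanishes for \<open>r = s = 1\<close> and is positive otherwise. The stationary distribution is a rational
  function of the matrix entries (Markov chain tree theorem), so positivity persists for small \<open>\<epsilon>\<close>.
  Game \<open>B\<close> is fair exactly at \<open>\<epsilon> = 0\<close> since there \<open>p\<^sub>0 p\<^sub>1 p\<^sub>2 = (1 - p\<^sub>0)(1 - p\<^sub>1)(1 - p\<^sub>2)\<close>, and lowering
  the \<open>p\<^sub>i\<close> makes it losing.
\<close>

subsection \<open>Stationary distributions\<close>

lemma forall_states: "(\<forall>i::3. Q i) \<longleftrightarrow> Q 0 \<and> Q 1 \<and> Q 2"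
proof -
  have "(\<forall>i::3. Q i) \<longleftrightarrow> (\<forall>i\<in>UNIV. Q i)" by simp
  then show ?thesis unfolding UNIV_states by simp
qed

text \<open>Only off-diagonal positivity is demanded because the games themselves have zero
  diagonals; it already makes every tree weight positive.\<close>

definition mixing :: "real^3^3 \<Rightarrow> bool" where
  "mixing P \<longleftrightarrow> (\<forall>i. (\<Sum>j\<in>UNIV. P $ i $ j) = 1) \<and> (\<forall>i j. 0 \<le> P $ i $ j) \<and>
     (\<forall>i j. i \<noteq> j \<longrightarrow> 0 < P $ i $ j)"

text \<open>Any \<open>i\<close> and \<open>j\<close> leave a third state \<open>k\<close> distinct
  from both, and the path from \<open>i\<close> through \<open>k\<close> to \<open>j\<close> has
  positive probability.\<close>

lemma mixing_mult:
  assumes "mixing A" "mixing B"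
  shows "mixing (A ** B)"
proof -
  have rows: "(\<Sum>j\<in>UNIV. (A ** B) $ i $ j) = 1" for i
  proof -
    have "(\<Sum>j\<in>UNIV. (A ** B) $ i $ j) = (\<Sum>k\<in>UNIV. A $ i $ k * (\<Sum>j\<in>UNIV. B $ k $ j))"
      unfolding matrix_matrix_mult_def by (simp add: sum_distrib_left) (rule sum.swap)
    then show ?thesis using assms by (simp add: mixing_def)
  qed
  have nonneg: "0 \<le> A $ i $ k * B $ k $ j" for i j k
    using assms by (simp add: mixing_def)
  have "0 < (A ** B) $ i $ j" if "i \<noteq> j" for i j
  proof -
    have "\<forall>i j::3. \<exists>k. k \<noteq> i \<and> k \<noteq> j"
      unfolding forall_states by (metis zero_neq_one by_state_simps(1,2,3))
    then obtain k where "k \<noteq> i" "k \<noteq> j" by blast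
    then have "0 < A $ i $ k * B $ k $ j"
      using assms unfolding mixing_def by (metis mult_pos_pos)
    then show ?thesis
      using nonneg by (simp add: matrix_matrix_mult_def sum_pos2)
  qed
  then show ?thesis
    using rows nonneg by (simp add: mixing_def matrix_matrix_mult_def sum_nonneg)
qed

lemma mat_power_0 [simp]: "mat_power A 0 = mat 1"
  and mat_power_Suc [simp]: "mat_power A (Suc n) = A ** mat_power A n"
  by (simp_all add: mat_power_def)

lemma mixing_mat_power: "mixing A \<Longrightarrow> 0 < n \<Longrightarrow> mixing (mat_power A n)"
proof (induction n)
  case (Suc n)
  then show ?case by (cases n) (simp_all add: mixing_mult)
qed simp

text \<open>The total weight of the spanning trees of the transition graph directed towards a given
  root; these weights are proportional to the stationary distribution.\<close>

definition tree_weight :: "real^3^3 \<Rightarrow> 3 \<Rightarrow> real" where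
  "tree_weight P = by_state
     (P $ 1 $ 0 * P $ 2 $ 0 + P $ 1 $ 0 * P $ 2 $ 1 + P $ 2 $ 0 * P $ 1 $ 2)
     (P $ 0 $ 1 * P $ 2 $ 1 + P $ 0 $ 1 * P $ 2 $ 0 + P $ 2 $ 1 * P $ 0 $ 2)
     (P $ 0 $ 2 * P $ 1 $ 2 + P $ 0 $ 2 * P $ 1 $ 0 + P $ 1 $ 2 * P $ 0 $ 1)"

lemma tree_weight_pos: "mixing P \<Longrightarrow> 0 < tree_weight P i"
proof -
  assume "mixing P"
  then have "i \<noteq> j \<Longrightarrow> 0 < P $ i $ j" for i j by (simp add: mixing_def)
  then have "\<forall>i. 0 < tree_weight P i"
    unfolding forall_states by (simp add: tree_weight_def add_pos_pos)
  then show ?thesis by simp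
qed

text \<open>For uniqueness, two balance equations and the normalisation form a linear system whose
  determinant is the total tree weight; Cramer's rule yields the single tree weights as
  numerators.\<close>

lemma stationary_distribution_iff:
  assumes "mixing P"
  shows "stationary_distribution P \<pi> \<longleftrightarrow>
    \<pi> = (\<chi> i. tree_weight P i / (\<Sum>j\<in>UNIV. tree_weight P j))" (is "_ \<longleftrightarrow> \<pi> = ?t")
proof -
  define W where "W = (\<Sum>j\<in>UNIV. tree_weight P j)"
  have W: "0 < W"
    unfolding W_def using tree_weight_pos[OF assms] by (intro sum_pos) auto
  have rows: "P $ 0 $ 0 = 1 - P $ 0 $ 1 - P $ 0 $ 2" "P $ 1 $ 1 = 1 - P $ 1 $ 0 - P $ 1 $ 2"
    "P $ 2 $ 2 = 1 - P $ 2 $ 0 - P $ 2 $ 1"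
    using assms by (simp_all add: mixing_def sum_states forall_states algebra_simps)
  \<comment> \<open>The row sums eliminate the diagonal entries, which do not occur in the tree
    weights; what remains is inflow equals outflow at each state.\<close>
  have fixpoint: "\<pi> v* P = \<pi> \<longleftrightarrow>
      \<pi> $ 1 * P $ 1 $ 0 + \<pi> $ 2 * P $ 2 $ 0 = \<pi> $ 0 * (P $ 0 $ 1 + P $ 0 $ 2) \<and>
      \<pi> $ 0 * P $ 0 $ 1 + \<pi> $ 2 * P $ 2 $ 1 = \<pi> $ 1 * (P $ 1 $ 0 + P $ 1 $ 2) \<and>
      \<pi> $ 0 * P $ 0 $ 2 + \<pi> $ 1 * P $ 1 $ 2 = \<pi> $ 2 * (P $ 2 $ 0 + P $ 2 $ 1)" for \<pi>
    by (simp add: vec_eq_iff forall_states vector_matrix_mult_def sum_states rows algebra_simps)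
  show ?thesis
  proof
    assume st: "stationary_distribution P \<pi>"
    have eqs: "\<pi> $ 1 * P $ 1 $ 0 + \<pi> $ 2 * P $ 2 $ 0 = \<pi> $ 0 * (P $ 0 $ 1 + P $ 0 $ 2)"
      "\<pi> $ 0 * P $ 0 $ 1 + \<pi> $ 2 * P $ 2 $ 1 = \<pi> $ 1 * (P $ 1 $ 0 + P $ 1 $ 2)"
      "\<pi> $ 0 + \<pi> $ 1 + \<pi> $ 2 = 1"
      using st unfolding stationary_distribution_def fixpoint sum_states by auto
    have "\<forall>i. \<pi> $ i * W = tree_weight P i"
      unfolding forall_states W_def sum_states using eqs
      by (simp add: tree_weight_def) (intro conjI; algebra)
    then show "\<pi> = ?t"
      using W by (simp add: vec_eq_iff W_def[symmetric] field_simps)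
  next
    assume "\<pi> = ?t"
    then have \<pi>: "\<pi> $ i = tree_weight P i / W" for i by (simp add: W_def)
    have "\<pi> v* P = \<pi>"
      unfolding fixpoint \<pi> using W by (simp add: divide_simps tree_weight_def) (simp add: algebra_simps)
    moreover have "(\<Sum>i\<in>UNIV. \<pi> $ i) = 1"
      unfolding \<pi> using W by (simp add: sum_divide_distrib[symmetric] W_def)
    ultimately show "stationary_distribution P \<pi>"
      using W tree_weight_pos[OF assms] by (simp add: stationary_distribution_def \<pi> less_imp_le)
  qed
qed

lemma the_stationary_eq:
  assumes "mixing P"
  shows "the_stationary P = (\<chi> i. tree_weight P i / (\<Sum>j\<in>UNIV. tree_weight P j))"
  unfolding the_stationary_def by (rule the_equality) (simp_all add: stationary_distribution_iff[OF assms])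

lemma stationary_distribution_the_stationary:
  "mixing P \<Longrightarrow> stationary_distribution P (the_stationary P)"
  by (simp add: stationary_distribution_iff the_stationary_eq)

subsection \<open>Continuity of the mean profit\<close>

lemma tendsto_matrix_matrix_mult [tendsto_intros]:
  fixes f g :: "'a \<Rightarrow> real^3^3"
  assumes "(f \<longlongrightarrow> A) F" "(g \<longlongrightarrow> B) F"
  shows "((\<lambda>x. f x ** g x) \<longlongrightarrow> A ** B) F"
  unfolding matrix_matrix_mult_def by (intro tendsto_intros assms)

lemma tendsto_vector_matrix_mult [tendsto_intros]:
  fixes g :: "'a \<Rightarrow> real^3^3"
  assumes "(f \<longlongrightarrow> v) F" "(g \<longlongrightarrow> B) F"
  shows "((\<lambda>x. f x v* g x) \<longlongrightarrow> v v* B) F"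
  unfolding vector_matrix_mult_def by (intro tendsto_intros assms)

lemma tendsto_mat_power [tendsto_intros]:
  assumes "(f \<longlongrightarrow> A) F"
  shows "((\<lambda>x. mat_power (f x) n) \<longlongrightarrow> mat_power A n) F"
  by (induction n) (auto intro!: tendsto_intros assms)

lemma tendsto_expected_profit [tendsto_intros]:
  assumes "(f \<longlongrightarrow> v) F" "(g \<longlongrightarrow> P) F"
  shows "((\<lambda>x. expected_profit (f x) (g x)) \<longlongrightarrow> expected_profit v P) F"
  unfolding expected_profit_def by (intro tendsto_intros assms)

lemma tendsto_tree_weight [tendsto_intros]:
  assumes "(f \<longlongrightarrow> P) F"
  shows "((\<lambda>x. tree_weight (f x) i) \<longlongrightarrow> tree_weight P i) F"
  unfolding tree_weight_def by_state_def
  by (cases "i = 0"; cases "i = 1"; simp; intro tendsto_intros assms)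

text \<open>The closed formula is continuous since its denominator has a positive limit. It is
  available for \<open>f x\<close> only eventually.\<close>

lemma tendsto_the_stationary:
  assumes "(f \<longlongrightarrow> P) F" "mixing P" "\<forall>\<^sub>F x in F. mixing (f x)"
  shows "((\<lambda>x. the_stationary (f x)) \<longlongrightarrow> the_stationary P) F"
proof -
  have "(\<Sum>j\<in>UNIV. tree_weight P j) > 0"
    using tree_weight_pos[OF assms(2)] by (intro sum_pos) auto
  then have "((\<lambda>x. \<chi> i. tree_weight (f x) i / (\<Sum>j\<in>UNIV. tree_weight (f x) j)) \<longlongrightarrow>
      (\<chi> i. tree_weight P i / (\<Sum>j\<in>UNIV. tree_weight P j))) F"
    by (intro tendsto_intros assms(1)) simp
  then show ?thesis
    unfolding the_stationary_eq[OF assms(2)]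
    by (rule Lim_transform_eventually)
      (use assms(3) in \<open>auto elim!: eventually_mono simp: the_stationary_eq\<close>)
qed

lemma tendsto_pattern_mean_profit:
  assumes A: "(f \<longlongrightarrow> A) F" "mixing A" "\<forall>\<^sub>F x in F. mixing (f x)"
    and B: "(g \<longlongrightarrow> B) F" "mixing B" "\<forall>\<^sub>F x in F. mixing (g x)"
    and "0 < r" "0 < s"
  shows "((\<lambda>x. pattern_mean_profit (f x) (g x) r s) \<longlongrightarrow> pattern_mean_profit A B r s) F"
proof -
  have "\<forall>\<^sub>F x in F. mixing (mat_power (f x) r ** mat_power (g x) s)"
    using A(3) B(3) by eventually_elim (simp add: mixing_mult mixing_mat_power assms)
  then have "((\<lambda>x. the_stationary (mat_power (f x) r ** mat_power (g x) s)) \<longlongrightarrow>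
      the_stationary (mat_power A r ** mat_power B s)) F"
    by (intro tendsto_the_stationary tendsto_intros A(1) B(1))
      (simp add: mixing_mult mixing_mat_power assms)
  then show ?thesis
    unfolding pattern_mean_profit_def Let_def by (intro tendsto_intros A(1) B(1))
qed

lemma tendsto_trans_mat:
  assumes "(f \<longlongrightarrow> p) F" "(g \<longlongrightarrow> q) F" "(h \<longlongrightarrow> r) F"
  shows "((\<lambda>x. trans_mat (f x) (g x) (h x)) \<longlongrightarrow> trans_mat p q r) F"
proof -
  have "\<forall>i j. ((\<lambda>x. trans_mat (f x) (g x) (h x) $ i $ j) \<longlongrightarrow> trans_mat p q r $ i $ j) F"
    unfolding forall_states trans_mat_def by (simp add: assms tendsto_diff)
  then show ?thesis by (intro vec_tendstoI) auto
qed

section \<open>Single games: mixing and sign of the mean profit\<close>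

lemma mixing_trans_mat:
  assumes "0 < p0" "p0 < 1" "0 < p1" "p1 < 1" "0 < p2" "p2 < 1"
  shows "mixing (trans_mat p0 p1 p2)"
  using assms by (simp add: mixing_def forall_states sum_states trans_mat_def)

text \<open>The profit is a net cycle flow: \<open>p0 * p1 * p2\<close> weighs the winning cycle 0,
  1, 2, 0 and the other product its reversal, so their difference decides the sign.\<close>

lemma mean_profit_trans_mat_neg:
  assumes "0 < p0" "p0 < 1" "0 < p1" "p1 < 1" "0 < p2" "p2 < 1"
    and less: "p0 * p1 * p2 < (1 - p0) * (1 - p1) * (1 - p2)"
  shows "mean_profit (trans_mat p0 p1 p2) < 0"
proof -
  let ?P = "trans_mat p0 p1 p2"
  define W where "W = (\<Sum>j\<in>UNIV. tree_weight ?P j)"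
  have mix: "mixing ?P" using assms by (simp add: mixing_trans_mat)
  have W: "0 < W"
    unfolding W_def using tree_weight_pos[OF mix] by (intro sum_pos) auto
  have "mean_profit ?P = 3 * (p0 * p1 * p2 - (1 - p0) * (1 - p1) * (1 - p2)) / W"
    unfolding mean_profit_def expected_profit_def the_stationary_eq[OF mix] W_def[symmetric]
    by (simp add: sum_states payoff_def trans_mat_def tree_weight_def add_divide_distrib[symmetric]
        diff_divide_distrib[symmetric]) (simp add: algebra_simps diff_divide_distrib add_divide_distrib)
  then show ?thesis using less W by (simp add: divide_neg_pos)
qed

subsection \<open>The fair case\<close>

text \<open>With \<open>c = (-1/2)^r\<close> this gives positivity of the fair pattern. For even
  \<open>s\<close> it is a product of two comparisons; for odd \<open>s\<close> the first two
  factors compare the wrong way, and the gap between \<open>(1 + x1)^2\<close> and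
  \<open>(1 + x2)^2\<close> must outweigh them. The case of equality, \<open>s = 1\<close> and
  \<open>c = -1/2\<close>, is excluded by \<open>nd\<close>.\<close>

lemma spectral_inequality:
  fixes x1 x2 c :: real
  assumes x: "0 < x1" "x1 < x2" "x1 + x2 = 1" and c: "-1/2 \<le> c" "c < 1"
    and s: "0 < s" and nd: "s = 1 \<Longrightarrow> c \<noteq> -1/2"
  shows "(1 - (-x2)^s) * (1 - c * (-x1)^s) * (1 + x1)^2 < (1 - (-x1)^s) * (1 - c * (-x2)^s) * (1 + x2)^2"
proof (cases "even s")
  case True
  define t1 t2 where "t1 = x1 ^ s" and "t2 = x2 ^ s"
  have t: "0 < t1" "t1 < t2" "t2 < 1"
    using x s by (auto simp: t1_def t2_def power_strict_mono power_less_one_iff)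
  have "c * t1 < 1" using t c by (smt (verit) mult_less_cancel_right2)
  then have p: "0 < (1 - t2) * (1 - c * t1)" using t by simp
  have "(1 - t1) * (1 - c * t2) - (1 - t2) * (1 - c * t1) = (1 - c) * (t2 - t1)"
    by (simp add: algebra_simps)
  also have "\<dots> > 0" using t c by simp
  finally have "(1 - t2) * (1 - c * t1) < (1 - t1) * (1 - c * t2)" by simp
  moreover have "(1 + x1)^2 < (1 + x2)^2" using x by (intro power_strict_mono) auto
  ultimately show ?thesis
    using p True by (simp add: t1_def t2_def mult_strict_mono)
next
  case False
  \<comment> \<open>For odd \<open>s \<ge> 3\<close> the worst value of \<open>c\<close> is \<open>-1/2\<close>, and there \<open>s = 3\<close> dominates all larger \<open>s\<close>,
    because \<open>x2 ^ n - x1 ^ n\<close> is decreasing in \<open>n\<close>.\<close>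
  define y1 y2 where "y1 = x1 ^ s" and "y2 = x2 ^ s"
  have y: "0 < y1" "y1 < y2" "y2 < 1"
    using x s by (auto simp: y1_def y2_def power_strict_mono power_less_one_iff)
  have goal: ?thesis if "(1 + y2) * (1 + c * y1) * (1 + x1)^2 < (1 + y1) * (1 + c * y2) * (1 + x2)^2"
    using that False by (simp add: y1_def y2_def)
  show ?thesis
  proof (cases "s = 1")
    case True
    have "(1 + y1) * (1 + c * y2) * (1 + x2)^2 - (1 + y2) * (1 + c * y1) * (1 + x1)^2
        = (1 + x1) * (1 + x2) * (x2 - x1) * (1 + c + c * (x1 + x2))"
      by (simp add: y1_def y2_def True algebra_simps power2_eq_square)
    also have "\<dots> = (1 + x1) * (1 + x2) * (x2 - x1) * (1 + 2 * c)"
      using x(3) by simp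
    also have "\<dots> > 0" using x c nd True by (auto intro!: mult_pos_pos)
    finally show ?thesis using goal by simp
  next
    case s1: False
    with False s have s3: "3 \<le> s" by (cases s rule: nat.exhaust; auto simp: numeral_3_eq_3; presburger)
    have y2: "y2 \<le> x2 ^ 3" unfolding y2_def using x s3 by (intro power_decreasing) auto
    define D where "D n = x2 ^ n - x1 ^ n" for n
    \<comment> \<open>\<open>x1\<close> and \<open>x2\<close> are the roots of
      \<open>X^2 - X + x1 * x2\<close>, so their powers obey this recurrence. Together with
      \<open>D n \<ge> 0\<close> it makes \<open>D\<close> nonincreasing from index 1 on.\<close>
    have D: "D (Suc (Suc n)) = D (Suc n) - x1 * x2 * D n" for n
    proof -
      have "D (Suc (Suc n)) = (x1 + x2) * D (Suc n) - x1 * x2 * D n"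
        by (simp add: D_def algebra_simps)
      then show ?thesis using x by simp
    qed
    have Dn: "0 \<le> D n" for n using x by (auto simp: D_def intro!: power_mono)
    have "D (Suc (Suc n)) \<le> D (Suc n)" for n
      using Dn[of n] x by (simp add: D)
    then have "D (Suc 2 + n) \<le> D 3" for n
      by (induction n) (auto simp: numeral_3_eq_3 intro: order_trans)
    from this[of "s - 3"] have "D s \<le> D 3" using s3 by simp
    also have "D 3 = (x2 - x1) * (1 - x1 * x2)"
      unfolding D_def using x(3) by algebra
    finally have Ds: "y2 - y1 \<le> (x2 - x1) * (1 - x1 * x2)" by (simp add: D_def y1_def y2_def)
    have cubic: "(1 - x1 * x2) * (1 + x1)^2 < 2 - x2^3"
    proof -
      have "2 - x2^3 - (1 - x1 * x2) * (1 + x1)^2 = x1 * (2 - 3 * x1 - x1^3)"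
        using x(3) by algebra
      \<comment> \<open>As the smaller of two numbers with sum 1, \<open>x1\<close> is below 1/2, so
        \<open>2 - 3 * x1 - x1^3 > 3/8\<close>.\<close>
      moreover have "x1^3 < (1/2)^3" using x by (intro power_strict_mono) auto
      then have "0 < x1 * (2 - 3 * x1 - x1^3)"
        using x by (intro mult_pos_pos) (auto simp: power3_eq_cube)
      ultimately show ?thesis by simp
    qed
    have "(y2 - y1) * (1 + x1)^2 \<le> (x2 - x1) * ((1 - x1 * x2) * (1 + x1)^2)"
      using mult_right_mono[OF Ds, of "(1 + x1)^2"] by (simp add: mult_ac)
    also have "\<dots> < (x2 - x1) * (2 - x2^3)" using cubic x by simp
    also have "\<dots> \<le> (x2 - x1) * ((1 + y1) * (2 - y2))"
    proof -
      have "2 - x2^3 \<le> 1 * (2 - y2)" using y2 by simp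
      also have "\<dots> \<le> (1 + y1) * (2 - y2)" using y by (intro mult_right_mono) auto
      finally show ?thesis using x by simp
    qed
    finally have key: "(y2 - y1) * (1 + x1)^2 < (x2 - x1) * ((1 + y1) * (2 - y2))" .
    \<comment> \<open>Twice the claim at \<open>c = -1/2\<close>. The factor 3 comes from
      \<open>(1 + x2)^2 - (1 + x1)^2 = 3 * (x2 - x1)\<close> and
      \<open>(1 + y2) * (2 - y1) - (1 + y1) * (2 - y2) = 3 * (y2 - y1)\<close>.\<close>
    have half: "(1 + y2) * (2 - y1) * (1 + x1)^2 < (1 + y1) * (2 - y2) * (1 + x2)^2"
    proof -
      have "(1 + y1) * (2 - y2) * (1 + x2)^2 - (1 + y2) * (2 - y1) * (1 + x1)^2
          = 3 * ((x2 - x1) * ((1 + y1) * (2 - y2)) - (y2 - y1) * (1 + x1)^2)"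
        using x(3) by algebra
      then show ?thesis using key by simp
    qed
    \<comment> \<open>The quotient \<open>(1 + c * y2) / (1 + c * y1)\<close> increases with
      \<open>c\<close>; at \<open>c = -1/2\<close> it equals
      \<open>(2 - y2) / (2 - y1)\<close>.\<close>
    have "(1 + c * y1) * (2 - y2) \<le> (1 + c * y2) * (2 - y1)"
    proof -
      have "(1 + c * y2) * (2 - y1) - (1 + c * y1) * (2 - y2) = (1 + 2 * c) * (y2 - y1)"
        by (simp add: algebra_simps)
      also have "\<dots> \<ge> 0" using c y by simp
      finally show ?thesis by simp
    qed
    moreover have "0 < 1 + c * y1"
    proof -
      have "- y1 / 2 \<le> c * y1" using mult_right_mono[OF c(1), of y1] y by simp
      then show ?thesis using y by simp
    qed
    ultimately have
      "(1 + y2) * (1 + c * y1) * (1 + x1)^2 * (2 - y1) < (1 + y1) * (1 + c * y2) * (1 + x2)^2 * (2 - y1)"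
    proof -
      assume a: "(1 + c * y1) * (2 - y2) \<le> (1 + c * y2) * (2 - y1)" and b: "0 < 1 + c * y1"
      have "(1 + y2) * (1 + c * y1) * (1 + x1)^2 * (2 - y1)
          = ((1 + y2) * (2 - y1) * (1 + x1)^2) * (1 + c * y1)" by (simp add: mult_ac)
      also have "\<dots> < ((1 + y1) * (2 - y2) * (1 + x2)^2) * (1 + c * y1)"
        using half b by (rule mult_strict_right_mono)
      also have "\<dots> = (1 + c * y1) * (2 - y2) * ((1 + y1) * (1 + x2)^2)" by (simp add: mult_ac)
      also have "\<dots> \<le> (1 + c * y2) * (2 - y1) * ((1 + y1) * (1 + x2)^2)"
        using a y by (intro mult_right_mono) auto
      finally show ?thesis by (simp add: mult_ac)
    qed
    then show ?thesis using goal y by simp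
  qed
qed

section \<open>Spectral description of the fair games\<close>

lemma eigenvector_mat_power:
  assumes "P *v g = e *\<^sub>R g"
  shows "(v v* mat_power P n) \<bullet> g = e ^ n * (v \<bullet> g)"
proof (induction n arbitrary: v)
  case (Suc n)
  have "(v v* mat_power P (Suc n)) \<bullet> g = ((v v* P) v* mat_power P n) \<bullet> g"
    by (simp add: vector_matrix_mul_assoc)
  also have "\<dots> = e ^ n * ((v v* P) \<bullet> g)" by (rule Suc)
  also have "(v v* P) \<bullet> g = e * (v \<bullet> g)" by (simp add: dot_lmul_matrix assms)
  finally show ?case by simp
qed simp

lemma inner_states: "v \<bullet> w = v $ 0 * w $ 0 + v $ 1 * w $ 1 + v $ 2 * (w $ 2 :: real)"
  for v w :: "real^3"
  by (simp add: inner_vec_def sum_states)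

text \<open>The fair matrix of game A has 0 on the diagonal and 1/2 elsewhere, so it fixes constants
  and multiplies vectors of sum zero by -1/2; \<open>g\<close> splits into its mean and such a
  remainder. Here \<open>1\<close> is the all-ones vector.\<close>

lemma fair_game_A_power:
  assumes "v \<bullet> 1 = 1"
  shows "(v v* mat_power (game_A 0) n) \<bullet> g = (1 - (-1/2) ^ n) * ((1 \<bullet> g) / 3) + (-1/2) ^ n * (v \<bullet> g)"
proof -
  let ?h = "g - ((1 \<bullet> g) / 3) *\<^sub>R 1"
  have "game_A 0 *v 1 = 1 *\<^sub>R 1"
    by (simp add: vec_eq_iff forall_states matrix_vector_mult_def sum_states game_A_def trans_mat_def)
  from eigenvector_mat_power[OF this, of v n]
  have one: "(v v* mat_power (game_A 0) n) \<bullet> 1 = 1" using assms by simp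
  have "game_A 0 *v ?h = (-1/2) *\<^sub>R ?h"
    by (simp add: vec_eq_iff forall_states matrix_vector_mult_def sum_states game_A_def trans_mat_def
        inner_states field_simps)
  from eigenvector_mat_power[OF this, of v n] show ?thesis
    using one assms by (simp add: inner_diff_right algebra_simps)
qed

text \<open>\<open>B\<close> has trace 0, so its eigenvalues besides 1 have sum -1, and their
  product is the determinant, which fairness makes \<open>2 * a * b\<^sup>2\<close>. That the
  quadratic factor alone annihilates \<open>f\<close> reflects zero stationary profit. The last fact
  drives the paradox: from the uniform distribution, one play of B wins on average.\<close>

lemma fair_game_B:
  fixes \<rho> :: real
  assumes "0 < \<rho>" "\<rho> < 1"
  defines "f \<equiv> (\<chi> i. by_state (2 * (\<rho>\<^sup>2 / (1 + \<rho>\<^sup>2)) - 1) (2 / (1 + \<rho>) - 1) (2 / (1 + \<rho>) - 1) i)"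
  defines "B \<equiv> game_B \<rho> 0"
  shows "expected_profit v B = v \<bullet> f"
    and "B *v (B *v f) + B *v f + (2 * \<rho>\<^sup>2 / ((1 + \<rho>)\<^sup>2 * (1 + \<rho>\<^sup>2))) *\<^sub>R f = 0"
    and "1 \<bullet> (B *v f) = 1 \<bullet> f"
    and "0 < 1 \<bullet> f"
proof -
  show "expected_profit v B = v \<bullet> f"
    by (simp add: expected_profit_def sum_states payoff_def B_def game_B_def trans_mat_def f_def inner_states
        algebra_simps)
  define a b where "a = \<rho>\<^sup>2 / (1 + \<rho>\<^sup>2)" and "b = 1 / (1 + \<rho>)"
  have pos: "1 + \<rho> > 0" "1 + \<rho>\<^sup>2 > 0" using assms(1) by (auto intro: add_pos_nonneg)
  have f: "f $ 0 = 2 * a - 1" "f $ 1 = 2 * b - 1" "f $ 2 = 2 * b - 1"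
    by (simp_all add: f_def a_def b_def)
  have B: "B = trans_mat a b b" by (simp add: B_def game_B_def a_def b_def)
  have row: "(B *v g) $ 0 = a * g $ 1 + (1 - a) * g $ 2"
    "(B *v g) $ 1 = (1 - b) * g $ 0 + b * g $ 2"
    "(B *v g) $ 2 = b * g $ 0 + (1 - b) * g $ 1" for g
    by (simp_all add: B matrix_vector_mult_def sum_states trans_mat_def)
  show "1 \<bullet> (B *v f) = 1 \<bullet> f"
    by (simp add: inner_states f row algebra_simps)
  have "1 \<bullet> f = 2 * a + 4 * b - 3" by (simp add: inner_states f)
  also have "\<dots> = (1 - \<rho>) ^ 3 / ((1 + \<rho>) * (1 + \<rho>\<^sup>2))"
  proof -
    have "1 + \<rho> \<noteq> 0" "1 + \<rho>\<^sup>2 \<noteq> 0" using pos by auto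
    then show ?thesis
      by (simp add: a_def b_def divide_simps) (simp add: algebra_simps power2_eq_square power3_eq_cube)
  qed
  also have "\<dots> > 0" using pos assms by simp
  finally show "0 < 1 \<bullet> f" .
  show "B *v (B *v f) + B *v f + (2 * \<rho>\<^sup>2 / ((1 + \<rho>)\<^sup>2 * (1 + \<rho>\<^sup>2))) *\<^sub>R f = 0"
  proof -
    have d: "2 * \<rho>\<^sup>2 / ((1 + \<rho>)\<^sup>2 * (1 + \<rho>\<^sup>2)) = 2 * a * b\<^sup>2"
      by (simp add: a_def b_def power_divide)
    \<comment> \<open>Fairness: both orientations of the 3-cycle have the same weight.\<close>
    have rel: "a * b\<^sup>2 = (1 - a) * (1 - b)\<^sup>2"
    proof -
      have "1 - a = 1 / (1 + \<rho>\<^sup>2)" "1 - b = \<rho> / (1 + \<rho>)"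
        using pos by (simp_all add: a_def b_def field_simps)
      then show ?thesis by (simp add: a_def b_def power_divide)
    qed
    show ?thesis
      unfolding vec_eq_iff forall_states
      by (simp add: d row f) (intro conjI; use rel in algebra)
  qed
qed

lemma obtain_roots_sum_1:
  fixes d :: real
  assumes "0 < d" "d < 1/4"
  obtains x1 x2 where "0 < x1" "x1 < x2" "x1 + x2 = 1" "x1 * x2 = d"
proof
  let ?\<delta> = "sqrt (1/4 - d)"
  show "0 < 1/2 - ?\<delta>"
    using assms real_sqrt_less_mono[of "1/4 - d" "1/4"] by (simp add: real_sqrt_divide)
  show "1/2 - ?\<delta> < 1/2 + ?\<delta>" "1/2 - ?\<delta> + (1/2 + ?\<delta>) = 1"
    using assms by auto
  have "?\<delta> * ?\<delta> = 1/4 - d" using assms by simp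
  then show "(1/2 - ?\<delta>) * (1/2 + ?\<delta>) = d" by (simp add: algebra_simps)
qed

section \<open>Profit of the pattern at zero bias\<close>

lemma fair_pattern_pos:
  fixes \<rho> :: real and r s :: nat
  assumes \<rho>: "0 < \<rho>" "\<rho> < 1" and rs: "0 < r" "0 < s" "\<not> (r = 1 \<and> s = 1)"
    and mixing: "mixing (game_A 0)" "mixing (game_B \<rho> 0)"
  shows "0 < pattern_mean_profit (game_A 0) (game_B \<rho> 0) r s"
proof -
  define A B where "A = game_A 0" and "B = game_B \<rho> 0"
  define f :: "real^3" where
    "f = (\<chi> i. by_state (2 * (\<rho>\<^sup>2 / (1 + \<rho>\<^sup>2)) - 1) (2 / (1 + \<rho>) - 1) (2 / (1 + \<rho>) - 1) i)"
  define d where "d = 2 * \<rho>\<^sup>2 / ((1 + \<rho>)\<^sup>2 * (1 + \<rho>\<^sup>2))"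
  define c :: real where "c = (-1/2) ^ r"
  define q where "q = (1 \<bullet> f) / 3"
  note fair = fair_game_B[OF \<rho>, folded f_def B_def d_def]
  have q: "0 < q" using fair(4) by (simp add: q_def)
  \<comment> \<open>Positivity of this polynomial amounts to \<open>d < 1/4\<close>, which gives
    distinct real roots; it degenerates at \<open>\<rho> = 1\<close>.\<close>
  have "(1 + \<rho>)\<^sup>2 * (1 + \<rho>\<^sup>2) - 8 * \<rho>\<^sup>2 = (1 - \<rho>)\<^sup>2 * (1 + 4 * \<rho> + \<rho>\<^sup>2)"
    by (simp add: power2_eq_square algebra_simps)
  also have "\<dots> > 0" using \<rho> by (intro mult_pos_pos) (auto intro!: add_pos_nonneg)
  finally have "8 * \<rho>\<^sup>2 < (1 + \<rho>)\<^sup>2 * (1 + \<rho>\<^sup>2)" by simp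
  moreover have "0 < (1 + \<rho>)\<^sup>2 * (1 + \<rho>\<^sup>2)"
    using \<rho> by (intro mult_pos_pos) (auto intro!: add_pos_nonneg)
  ultimately have "0 < d" "d < 1/4" using \<rho> by (auto simp: d_def divide_simps)
  then obtain x1 x2 where x: "0 < x1" "x1 < x2" "x1 + x2 = 1" and x12: "x1 * x2 = d"
    by (rule obtain_roots_sum_1)
  \<comment> \<open>Spectral projections of \<open>f\<close>: \<open>B + x2\<close> annihilates the
    \<open>-x2\<close> component and multiplies the \<open>-x1\<close> component by
    \<open>x2 - x1\<close>; symmetrically for \<open>f2\<close>.\<close>
  define f1 f2 where "f1 = (1 / (x2 - x1)) *\<^sub>R (B *v f + x2 *\<^sub>R f)"
    and "f2 = (- 1 / (x2 - x1)) *\<^sub>R (B *v f + x1 *\<^sub>R f)"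
  have BB: "B *v (B *v f) = - (B *v f) - d *\<^sub>R f"
    using fair(2) by (simp add: algebra_simps eq_neg_iff_add_eq_0)
  have "f1 + f2 = (1 / (x2 - x1)) *\<^sub>R ((x2 - x1) *\<^sub>R f)"
    unfolding f1_def f2_def by (simp add: algebra_simps)
  then have f12: "f = f1 + f2" using x by simp
  have root_eigen: "B *v (k *\<^sub>R (B *v f + y *\<^sub>R f)) = (-x) *\<^sub>R (k *\<^sub>R (B *v f + y *\<^sub>R f))"
    if "x + y = 1" "x * y = d" for x y k
  proof -
    have y: "y - 1 = - x" using that by simp
    have "B *v (k *\<^sub>R (B *v f + y *\<^sub>R f)) = k *\<^sub>R ((y - 1) *\<^sub>R (B *v f) - d *\<^sub>R f)"
      by (simp add: matrix_vector_right_distrib matrix_vector_mult_scaleR BB algebra_simps)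
    also have "\<dots> = (-x) *\<^sub>R (k *\<^sub>R (B *v f + y *\<^sub>R f))"
      unfolding y that(2)[symmetric] by (simp add: algebra_simps)
    finally show ?thesis .
  qed
  have eigen1: "B *v f1 = (-x1) *\<^sub>R f1" unfolding f1_def by (rule root_eigen) (use x x12 in auto)
  have eigen2: "B *v f2 = (-x2) *\<^sub>R f2" unfolding f2_def
    by (rule root_eigen) (use x x12 in \<open>auto simp: mult.commute\<close>)
  have u1: "(1 \<bullet> f1) / 3 = q * (1 + x2) / (x2 - x1)"
    and u2: "(1 \<bullet> f2) / 3 = - (q * (1 + x1) / (x2 - x1))"
    using x(2) by (simp_all add: f1_def f2_def q_def inner_add_right fair(3) divide_simps)
      (simp_all add: algebra_simps)
  \<comment> \<open>\<open>\<pi>\<close> is the distribution at the start of a period,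
    \<open>\<sigma>\<close> the one at the switch from A to B.\<close>
  define \<pi> where "\<pi> = the_stationary (mat_power A r ** mat_power B s)"
  define \<sigma> where "\<sigma> = \<pi> v* mat_power A r"
  have "stationary_distribution (mat_power A r ** mat_power B s) \<pi>"
    unfolding \<pi>_def A_def B_def
    by (intro stationary_distribution_the_stationary mixing_mult mixing_mat_power mixing rs)
  then have \<pi>1: "\<pi> \<bullet> 1 = 1" and \<pi>: "\<sigma> v* mat_power B s = \<pi>"
    by (simp_all add: stationary_distribution_def inner_vec_def \<sigma>_def vector_matrix_mul_assoc)
  \<comment> \<open>Along an eigenvector the period closes to a scalar equation: the A block leads
    from \<open>\<pi> \<bullet> g\<close> to \<open>\<sigma> \<bullet> g\<close>, and the B block
    leads back with factor \<open>e ^ s\<close>.\<close>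
  have z: "(1 - c * e ^ s) * (\<sigma> \<bullet> g) = (1 - c) * ((1 \<bullet> g) / 3)" if "B *v g = e *\<^sub>R g" for e g
  proof -
    have "\<sigma> \<bullet> g = (1 - c) * ((1 \<bullet> g) / 3) + c * (\<pi> \<bullet> g)"
      unfolding \<sigma>_def c_def A_def by (rule fair_game_A_power[OF \<pi>1])
    moreover have "\<pi> \<bullet> g = e ^ s * (\<sigma> \<bullet> g)"
      using eigenvector_mat_power[OF that, of \<sigma> s] \<pi> by simp
    ultimately have "\<sigma> \<bullet> g = (1 - c) * ((1 \<bullet> g) / 3) + c * (e ^ s * (\<sigma> \<bullet> g))" by metis
    moreover have "(1 - c * e ^ s) * (\<sigma> \<bullet> g) = \<sigma> \<bullet> g - c * (e ^ s * (\<sigma> \<bullet> g))"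
      by (simp add: left_diff_distrib)
    ultimately show ?thesis by linarith
  qed
  have c: "-1/2 \<le> c" "c < 1" "r \<noteq> 1 \<Longrightarrow> c \<noteq> -1/2"
  proof -
    have abs: "\<bar>c\<bar> = (1/2) ^ r" by (simp add: c_def power_abs)
    have "(1/2::real) ^ r \<le> (1/2) ^ 1" using rs by (intro power_decreasing) auto
    then have "\<bar>c\<bar> \<le> 1/2" using abs by simp
    then show "-1/2 \<le> c" and "c < 1" by (auto simp: abs_le_iff)
    assume "r \<noteq> 1"
    then have "(1/2::real) ^ r \<le> (1/2) ^ 2" using rs by (intro power_decreasing) auto
    then show "c \<noteq> -1/2" using abs by (auto simp: power2_eq_square)
  qed
  define t1 t2 where "t1 = (-x1) ^ s" and "t2 = (-x2) ^ s"
  have pos: "0 < 1 - c * (-x) ^ s" if "0 < x" "x < 1" for x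
  proof -
    have "\<bar>(-x) ^ s\<bar> < 1" using that rs by (simp add: power_abs power_less_one_iff)
    moreover have "\<bar>c\<bar> \<le> 1" using c by auto
    ultimately have "\<bar>c * (-x) ^ s\<bar> < 1" unfolding abs_mult
      by (smt (verit) abs_ge_zero mult_left_le_one_le)
    then show ?thesis by linarith
  qed
  have pos1: "0 < 1 - c * t1" and pos2: "0 < 1 - c * t2"
    unfolding t1_def t2_def using pos[of x1] pos[of x2] x by linarith+
  have z1: "\<sigma> \<bullet> f1 = (1 - c) * q / (x2 - x1) * ((1 + x2) / (1 - c * t1))"
  proof -
    have "\<sigma> \<bullet> f1 = (1 - c) * ((1 \<bullet> f1) / 3) / (1 - c * t1)"
      using z[OF eigen1, folded t1_def] pos1 by (metis less_irrefl nonzero_mult_div_cancel_left)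
    then show ?thesis unfolding u1 by (simp add: mult_ac)
  qed
  have z2: "\<sigma> \<bullet> f2 = - ((1 - c) * q / (x2 - x1) * ((1 + x1) / (1 - c * t2)))"
  proof -
    have "\<sigma> \<bullet> f2 = (1 - c) * ((1 \<bullet> f2) / 3) / (1 - c * t2)"
      using z[OF eigen2, folded t2_def] pos2 by (metis less_irrefl nonzero_mult_div_cancel_left)
    then show ?thesis unfolding u2 by (simp add: mult_ac)
  qed
  have geo: "(\<Sum>v<s. (-x) ^ v) = (1 - (-x) ^ s) / (1 + x)" if "0 < x" for x :: real
    using that by (simp add: sum_gp_strict)
  have "(\<Sum>v<s. expected_profit (\<pi> v* (mat_power A r ** mat_power B v)) B)
      = (\<Sum>v<s. (-x1) ^ v * (\<sigma> \<bullet> f1) + (-x2) ^ v * (\<sigma> \<bullet> f2))"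
    unfolding vector_matrix_mul_assoc[symmetric] \<sigma>_def[symmetric] fair(1)
    by (simp add: f12 inner_add_right eigenvector_mat_power[OF eigen1] eigenvector_mat_power[OF eigen2])
  also have "\<dots> = (1 - t1) / (1 + x1) * (\<sigma> \<bullet> f1) + (1 - t2) / (1 + x2) * (\<sigma> \<bullet> f2)"
    using x by (simp add: sum.distrib sum_distrib_right[symmetric] geo t1_def t2_def)
  also have "\<dots> = (1 - c) * q / (x2 - x1) *
      ((1 - t1) * (1 + x2) / ((1 + x1) * (1 - c * t1)) - (1 - t2) * (1 + x1) / ((1 + x2) * (1 - c * t2)))"
  proof -
    have "a / b * (k * (m / n)) + a' / b' * - (k * (m' / n')) = k * (a * m / (b * n) - a' * m' / (b' * n'))"
      for a b k m n a' b' m' n' :: real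
      by (simp add: right_diff_distrib mult_ac)
    then show ?thesis unfolding z1 z2 .
  qed
  also have "\<dots> > 0"
  proof -
    \<comment> \<open>This is \<open>spectral_inequality\<close> divided by the positive number
      \<open>(1 + x1) * (1 + x2) * (1 - c * t1) * (1 - c * t2)\<close>.\<close>
    have "(1 - t2) * (1 + x1) / ((1 + x2) * (1 - c * t2)) < (1 - t1) * (1 + x2) / ((1 + x1) * (1 - c * t1))"
      using spectral_inequality[OF x c(1,2) rs(2)] c(3) rs(3) pos1 pos2 x
      unfolding t1_def[symmetric] t2_def[symmetric]
      by (simp add: divide_less_eq less_divide_eq mult_ac power2_eq_square) (auto simp: field_simps)
    then show ?thesis using c q x by (intro mult_pos_pos) auto
  qed
  finally have "0 < (\<Sum>v<s. expected_profit (\<pi> v* (mat_power A r ** mat_power B v)) B)" .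
  moreover have "expected_profit v A = 0" for v
    by (simp add: expected_profit_def sum_states payoff_def A_def game_A_def trans_mat_def)
  ultimately show ?thesis
    using rs by (simp add: pattern_mean_profit_def A_def[symmetric] B_def[symmetric] \<pi>_def[symmetric])
qed

section \<open>Passage to small positive bias\<close>

theorem corollary8:
  fixes \<rho> :: real and r s :: nat
  assumes "0 < \<rho>" and "\<rho> < 1"
    and "0 < r" and "0 < s"
    and "\<not> (r = 1 \<and> s = 1)"
  shows "\<exists>\<epsilon>\<^sub>0>0. \<forall>\<epsilon>. 0 < \<epsilon> \<and> \<epsilon> < \<epsilon>\<^sub>0 \<longrightarrow>
    mean_profit (game_A \<epsilon>) < 0 \<and>
    mean_profit (game_B \<rho> \<epsilon>) < 0 \<and>
    pattern_mean_profit (game_A \<epsilon>) (game_B \<rho> \<epsilon>) r s > 0"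
proof -
  define a b where "a = \<rho>\<^sup>2 / (1 + \<rho>\<^sup>2)" and "b = 1 / (1 + \<rho>)"
  have sq: "0 < 1 + \<rho>\<^sup>2" by (intro add_pos_nonneg) auto
  have ab: "0 < a" "a < 1" "0 < b" "b < 1"
    using assms sq by (auto simp: a_def b_def)
  have fairB: "a * b * b = (1 - a) * (1 - b) * (1 - b)"
  proof -
    have "1 - a = 1 / (1 + \<rho>\<^sup>2)" "1 - b = \<rho> / (1 + \<rho>)"
      using assms(1) sq by (simp_all add: a_def b_def field_simps)
    then show ?thesis by (simp add: a_def b_def power2_eq_square)
  qed
  have gA: "game_A \<epsilon> = trans_mat (1/2 - \<epsilon>) (1/2 - \<epsilon>) (1/2 - \<epsilon>)"
    and gB: "game_B \<rho> \<epsilon> = trans_mat (a - \<epsilon>) (b - \<epsilon>) (b - \<epsilon>)" for \<epsilon>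
    by (simp_all add: game_A_def game_B_def a_def b_def)
  \<comment> \<open>Below this bound \<open>1/2 - \<epsilon>\<close>, \<open>a - \<epsilon>\<close>
    and \<open>b - \<epsilon>\<close> stay positive.\<close>
  have small: "0 < min (1/2) (min a b)" using ab by simp
  have range: "\<forall>\<^sub>F \<epsilon> in at_right 0. 0 < \<epsilon> \<and> \<epsilon> < min (1/2) (min a b)"
    unfolding eventually_at_right_field using small by blast
  have mixA: "mixing (game_A \<epsilon>)" and mixB: "mixing (game_B \<rho> \<epsilon>)"
    if "0 \<le> \<epsilon>" "\<epsilon> < min (1/2) (min a b)" for \<epsilon>
    using that ab by (auto simp: gA gB intro!: mixing_trans_mat)
  have "((\<lambda>\<epsilon>. pattern_mean_profit (game_A \<epsilon>) (game_B \<rho> \<epsilon>) r s) \<longlongrightarrow>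
      pattern_mean_profit (game_A 0) (game_B \<rho> 0) r s) (at_right 0)"
  proof (intro tendsto_pattern_mean_profit assms)
    show "(game_A \<longlongrightarrow> game_A 0) (at_right 0)" "(game_B \<rho> \<longlongrightarrow> game_B \<rho> 0) (at_right 0)"
      unfolding gA[abs_def] gB[abs_def] by (intro tendsto_trans_mat tendsto_intros)+
    show "\<forall>\<^sub>F \<epsilon> in at_right 0. mixing (game_A \<epsilon>)" "\<forall>\<^sub>F \<epsilon> in at_right 0. mixing (game_B \<rho> \<epsilon>)"
      using range by (auto elim!: eventually_mono intro: mixA mixB)
  qed (use small in \<open>auto intro!: mixA mixB\<close>)
  moreover have "0 < pattern_mean_profit (game_A 0) (game_B \<rho> 0) r s"
    using small by (intro fair_pattern_pos assms mixA mixB) auto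
  ultimately have "\<forall>\<^sub>F \<epsilon> in at_right 0. 0 < pattern_mean_profit (game_A \<epsilon>) (game_B \<rho> \<epsilon>) r s"
    by (rule order_tendstoD)
  then have "\<forall>\<^sub>F \<epsilon> in at_right 0. mean_profit (game_A \<epsilon>) < 0 \<and> mean_profit (game_B \<rho> \<epsilon>) < 0 \<and>
      0 < pattern_mean_profit (game_A \<epsilon>) (game_B \<rho> \<epsilon>) r s"
    using range
  proof eventually_elim
    case (elim \<epsilon>)
    \<comment> \<open>Both games are fair at \<open>\<epsilon> = 0\<close>, so continuity cannot
      give these two signs; the cycle criterion does.\<close>
    have "mean_profit (game_A \<epsilon>) < 0" unfolding gA
      using elim by (intro mean_profit_trans_mat_neg mult_strict_mono) auto
    moreover have "mean_profit (game_B \<rho> \<epsilon>) < 0" unfolding gB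
    proof (rule mean_profit_trans_mat_neg)
      \<comment> \<open>The winning product drops below its fair value and the losing product rises
        above it; \<open>fairB\<close> equates the two fair values.\<close>
      have "(a - \<epsilon>) * (b - \<epsilon>) * (b - \<epsilon>) < a * b * b"
        using elim by (intro mult_strict_mono) auto
      also have "\<dots> < (1 - (a - \<epsilon>)) * (1 - (b - \<epsilon>)) * (1 - (b - \<epsilon>))"
        unfolding fairB using elim ab by (intro mult_strict_mono) auto
      finally show "(a - \<epsilon>) * (b - \<epsilon>) * (b - \<epsilon>) < (1 - (a - \<epsilon>)) * (1 - (b - \<epsilon>)) * (1 - (b - \<epsilon>))" .
    qed (use elim ab in auto)
    ultimately show ?case using elim by simp
  qed
  then show ?thesis by (auto simp: eventually_at_right_field)
qed

end
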